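(* Let $0<P_{fa}<P_d<1$ and let $K\ge1$ be an integer. For a Swerling I fluctuating target with (mean) radar cross section $\sigma>0$ at orbital phase $\theta$ with $\mathcal{G}(v_{\mathrm{rel}}(\theta))>0$, the maximum monostatic sensing range achieving detection probability $P_d$ at false alarm rate $P_{fa}$ with $K$ non-coherently integrated coherent processing intervals (CPIs) is $$R_{\max}(\theta,\sigma,K)=\left[\frac{\mathrm{EIRP}\cdot G_r\,\lambda^2\,\sigma\,NM\,\mathcal{G}(v_{\mathrm{rel}}(\theta))\,K^{\kappa}}{(4\pi)^3k_BT_{\mathrm{sys}}B\,\gamma_{\mathrm{th}}}\right]^{1/4},$$ where $\gamma_{\mathrm{th}}=\ln(P_{fa})/\ln(P_d)-1$ is the Swerling I detection threshold (about $21.1$ dB for $P_d=0.9$, $P_{fa}=10^{-6}$) and $\kappa\approx0.85$ is the non-coherent integration efficiency exponent.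
   Context: Parameters (all positive): $\mathrm{EIRP}$ (effective isotropic radiated power), receive gain $G_r$, wavelength $\lambda$, Boltzmann constant $k_B$, system temperature $T_{\mathrm{sys}}$, bandwidth $B=N\Delta f$, number of subcarriers $N$, subcarrier spacing $\Delta f$, symbols per CPI $M$, carrier frequency $f_c$, speed of light $c$. The relative radial velocity at orbital phase $\theta$ is $v_{\mathrm{rel}}(\theta)$, and $$\mathcal{G}(v)=\mathrm{sinc}^2\!\left(\frac{2vf_c}{c\,\Delta f}\right)\eta_{\mathrm{impl}},\qquad \mathrm{sinc}(x)=\frac{\sin\pi x}{\pi x},\qquad \eta_{\mathrm{impl}}\in(0,1].$$ The average single-CPI output SNR at range $R>0$ is $$\gamma(\theta,R,\sigma)=\frac{\mathrm{EIRP}\cdot G_r\lambda^2\sigma\,NM\,\mathcal{G}(v_{\mathrm{rel}}(\theta))}{(4\pi)^3R^4k_BT_{\mathrm{sys}}B}.$$ Detection model: for a Swerling I target, the detection probability at average SNR $\bar\gamma$ and false alarm rate $P_{fa}$ is $P_{fa}^{1/(1+\bar\gamma)}$. Non-coherent integration of $K$ CPIs is modelled as an integration gain $K^\kappa$, i.e. the effective average SNR is $\bar\gamma=K^{\kappa}\gamma(\theta,R,\sigma)$, where $\kappa$ is a fixed empirical exponent ($\approx0.85$; the gain is exactly $1$ for $K=1$). "Maximum sensing range achieving detection probability $P_d$" means the largest $R>0$ for which the resulting detection probability is at least $P_d$. *)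

theory Defs
  imports "HOL-Analysis.Analysis"
begin

text \<open>The normalized cardinal sine, with its removable singularity at 0 filled in.
  It is not the unnormalized sine quotient of the theory \<open>Sinc_Integral\<close>.\<close>

definition nsinc :: "real \<Rightarrow> real" where
  "nsinc x = (if x = 0 then 1 else sin (pi * x) / (pi * x))"

text \<open>The fields \<open>eta_impl\<close> and \<open>kappa\<close> are the implementation
  efficiency and the non-coherent integration exponent, and \<open>v_rel\<close> maps the orbital
  phase to the relative radial velocity. All quantities are in consistent units on a linear
  (not dB) scale.\<close>

record sensing_system =
  EIRP :: real
  rx_gain :: real
  wavelength :: real
  boltzmann :: real
  sys_temp :: real
  num_subcarriers :: nat
  subcarrier_spacing :: real
  symbols_per_cpi :: nat
  carrier_freq :: real
  light_speed :: real
  eta_impl :: real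
  kappa :: real
  v_rel :: "real \<Rightarrow> real"

definition positive_parameters :: "sensing_system \<Rightarrow> bool" where
  "positive_parameters S \<longleftrightarrow>
     EIRP S > 0 \<and> rx_gain S > 0 \<and> wavelength S > 0 \<and> boltzmann S > 0 \<and> sys_temp S > 0 \<and>
     num_subcarriers S > 0 \<and> subcarrier_spacing S > 0 \<and> symbols_per_cpi S > 0 \<and>
     carrier_freq S > 0 \<and> light_speed S > 0 \<and> 0 < eta_impl S \<and> eta_impl S \<le> 1"

definition bandwidth :: "sensing_system \<Rightarrow> real" where
  "bandwidth S = real (num_subcarriers S) * subcarrier_spacing S"

definition proc_gain :: "sensing_system \<Rightarrow> real \<Rightarrow> real" where
  "proc_gain S v =
     (nsinc (2 * v * carrier_freq S / (light_speed S * subcarrier_spacing S)))\<^sup>2 * eta_impl S"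

definition cpi_snr :: "sensing_system \<Rightarrow> real \<Rightarrow> real \<Rightarrow> real \<Rightarrow> real" where
  "cpi_snr S \<theta> R \<sigma> =
     (EIRP S * rx_gain S * (wavelength S)\<^sup>2 * \<sigma>
        * real (num_subcarriers S) * real (symbols_per_cpi S) * proc_gain S (v_rel S \<theta>))
     / ((4 * pi) ^ 3 * R ^ 4 * boltzmann S * sys_temp S * bandwidth S)"

definition integrated_snr :: "sensing_system \<Rightarrow> nat \<Rightarrow> real \<Rightarrow> real \<Rightarrow> real \<Rightarrow> real" where
  "integrated_snr S K \<theta> R \<sigma> = real K powr kappa S * cpi_snr S \<theta> R \<sigma>"

text \<open>Detection probability of a Swerling I target at false alarm rate \<open>Pfa\<close> and average
  SNR \<open>\<gamma>\<close>.\<close>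

definition swerling1_pd :: "real \<Rightarrow> real \<Rightarrow> real" where
  "swerling1_pd Pfa \<gamma> = Pfa powr (1 / (1 + \<gamma>))"

definition swerling1_threshold :: "real \<Rightarrow> real \<Rightarrow> real" where
  "swerling1_threshold Pfa Pd = ln Pfa / ln Pd - 1"

text \<open>The maximum must be attained, so the predicate determines \<open>R\<close> uniquely.\<close>

definition is_max_sensing_range ::
  "sensing_system \<Rightarrow> real \<Rightarrow> real \<Rightarrow> nat \<Rightarrow> real \<Rightarrow> real \<Rightarrow> real \<Rightarrow> bool" where
  "is_max_sensing_range S \<theta> \<sigma> K Pfa Pd R \<longleftrightarrow>
     R > 0 \<and> swerling1_pd Pfa (integrated_snr S K \<theta> R \<sigma>) \<ge> Pd \<and>
     (\<forall>R'>0. swerling1_pd Pfa (integrated_snr S K \<theta> R' \<sigma>) \<ge> Pd \<longrightarrow> R' \<le> R)"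

definition to_dB :: "real \<Rightarrow> real" where
  "to_dB x = 10 * log 10 x"

end

theory Submission
  imports Defs
begin

text \<open>The Swerling I detection probability reaches \<open>Pd\<close> exactly when the SNR reaches the threshold
  (take logarithms, which are negative). The integrated SNR is a positive constant divided by
  \<open>R ^ 4\<close>, so this condition is an upper bound on \<open>R\<close> that is attained at the fourth root.\<close>

lemma swerling1_pd_ge_iff:
  assumes "0 < Pfa" "0 < Pd" "Pd < 1" "\<gamma> > - 1"
  shows "swerling1_pd Pfa \<gamma> \<ge> Pd \<longleftrightarrow> \<gamma> \<ge> swerling1_threshold Pfa Pd"
proof -
  have "ln Pd < 0"
    using assms by simp
  have "swerling1_pd Pfa \<gamma> \<ge> Pd \<longleftrightarrow> ln Pd \<le> ln (Pfa powr (1 / (1 + \<gamma>)))"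
    unfolding swerling1_pd_def using assms by (subst ln_le_cancel_iff) auto
  \<comment> \<open>Clearing the denominator keeps the direction because
    \<open>\<gamma> > - 1\<close>; the later division by the negative \<open>ln Pd\<close> reverses
    it.\<close>
  also have "\<dots> \<longleftrightarrow> ln Pd * (1 + \<gamma>) \<le> ln Pfa"
    using assms by (simp add: ln_powr pos_le_divide_eq)
  also have "\<dots> \<longleftrightarrow> \<gamma> \<ge> swerling1_threshold Pfa Pd"
    unfolding swerling1_threshold_def using \<open>ln Pd < 0\<close>
    by (simp add: neg_divide_le_eq algebra_simps)
  finally show ?thesis .
qed

text \<open>Both logarithms are negative and \<open>ln Pfa\<close> lies farther from 0, so their
  quotient exceeds 1. This is what makes the fourth root below a positive range.\<close>

lemma swerling1_threshold_pos:
  assumes "0 < Pfa" "Pfa < Pd" "Pd < 1"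
  shows "swerling1_threshold Pfa Pd > 0"
proof -
  have "ln Pd < 0" "ln Pfa < ln Pd"
    using assms by simp_all
  then show ?thesis
    unfolding swerling1_threshold_def by (simp add: neg_less_divide_eq)
qed

lemma le_powr_inverse_nat_iff:
  fixes x y :: real
  assumes "0 < x" "0 < y" "n > 0"
  shows "x \<le> y powr (1 / real n) \<longleftrightarrow> x ^ n \<le> y"
proof -
  have "(y powr (1 / real n)) ^ n = y"
    using assms by (simp add: powr_power)
  then show ?thesis
    using power_mono_iff[of x "y powr (1 / real n)" n] assms by simp
qed

text \<open>Isolates the dependence on \<open>R\<close>. No condition on \<open>R\<close> is needed:
  at \<open>R = 0\<close> both sides are 0, since division by zero yields 0.\<close>

lemma integrated_snr_eq:
  "integrated_snr S K \<theta> R \<sigma> =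
     (EIRP S * rx_gain S * (wavelength S)\<^sup>2 * \<sigma>
        * real (num_subcarriers S) * real (symbols_per_cpi S)
        * proc_gain S (v_rel S \<theta>) * real K powr kappa S)
     / ((4 * pi) ^ 3 * boltzmann S * sys_temp S * bandwidth S) / R ^ 4"
  by (simp add: integrated_snr_def cpi_snr_def mult_ac)

lemma is_max_sensing_range_powr:
  assumes "0 < Pfa" "Pfa < Pd" "Pd < 1" and "A > 0"
    and snr: "\<And>R. integrated_snr S K \<theta> R \<sigma> = A / R ^ 4"
  shows "is_max_sensing_range S \<theta> \<sigma> K Pfa Pd ((A / swerling1_threshold Pfa Pd) powr (1 / 4))"
proof -
  let ?t = "swerling1_threshold Pfa Pd"
  have "?t > 0"
    using assms by (simp add: swerling1_threshold_pos)
  \<comment> \<open>One direction, taken at the root itself, gives attainment; the other gives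
    maximality.\<close>
  have detect: "swerling1_pd Pfa (integrated_snr S K \<theta> R \<sigma>) \<ge> Pd \<longleftrightarrow> R \<le> (A / ?t) powr (1 / 4)"
    if "R > 0" for R
  proof -
    have "A / R ^ 4 > 0"
      using that \<open>A > 0\<close> by simp
    then have "swerling1_pd Pfa (integrated_snr S K \<theta> R \<sigma>) \<ge> Pd \<longleftrightarrow> ?t \<le> A / R ^ 4"
      using assms by (simp add: swerling1_pd_ge_iff)
    also have "\<dots> \<longleftrightarrow> R ^ 4 \<le> A / ?t"
      using that \<open>?t > 0\<close> by (simp add: pos_le_divide_eq mult.commute)
    also have "\<dots> \<longleftrightarrow> R \<le> (A / ?t) powr (1 / 4)"
      using le_powr_inverse_nat_iff[of R "A / ?t" 4] that \<open>?t > 0\<close> \<open>A > 0\<close> by simp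
    finally show ?thesis .
  qed
  have "(A / ?t) powr (1 / 4) > 0"
    using \<open>?t > 0\<close> \<open>A > 0\<close> by simp
  then show ?thesis
    unfolding is_max_sensing_range_def using detect by blast
qed

text \<open>The exact value is about 130.13. The tolerance of 0.05 dB around 21.1 dB allows roughly
  127.4 to 130.3, so the upper bound has to be much tighter than the lower one.\<close>

lemma swerling1_threshold_bounds:
  "129 \<le> swerling1_threshold (1 / 10 ^ 6) (9 / 10)"
  "swerling1_threshold (1 / 10 ^ 6) (9 / 10) \<le> 130.2"
proof -
  let ?l = "ln (10 / 9 :: real)"
  have "?l > 0"
    by simp
  have "ln (9 / 10 :: real) = - ?l"
    by (simp add: ln_div)
  moreover have "ln (1 / 10 ^ 6 :: real) = - (6 * ln 10)"
    using ln_realpow[of 10 6] by (simp add: ln_div)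
  ultimately have t: "swerling1_threshold (1 / 10 ^ 6) (9 / 10) = 6 * ln 10 / ?l - 1"
    by (simp add: swerling1_threshold_def)
  \<comment> \<open>The bound 129 means \<open>130 * ?l \<le> 6 * ln 10\<close>; halving gives the
    exponents 65 and 3.\<close>
  have "ln ((10 / 9 :: real) ^ 65) \<le> ln (10 ^ 3)"
    by (subst ln_le_cancel_iff) (simp_all add: power_divide divide_simps)
  then have "65 * ?l \<le> 3 * ln 10"
    by (simp only: ln_realpow of_nat_numeral)
  then show "129 \<le> swerling1_threshold (1 / 10 ^ 6) (9 / 10)"
    using \<open>?l > 0\<close> unfolding t by (simp add: field_simps)
  \<comment> \<open>The bound 130.2 means \<open>30 * ln 10 \<le> 656 * ?l\<close>. As 656 = 16 *
    41, passing through 75, just above \<open>10 powr (30 / 16)\<close> and below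
    \<open>(10 / 9) ^ 41\<close>, avoids the power 656.\<close>
  have "ln (10 ^ 30) \<le> ln (75 ^ 16 :: real)"
    by (subst ln_le_cancel_iff) simp_all
  then have "30 * ln 10 \<le> 16 * ln (75 :: real)"
    by (simp only: ln_realpow of_nat_numeral)
  moreover have "ln 75 \<le> ln ((10 / 9 :: real) ^ 41)"
    by (subst ln_le_cancel_iff) (simp_all add: power_divide divide_simps)
  then have "ln 75 \<le> 41 * ?l"
    by (simp only: ln_realpow of_nat_numeral)
  ultimately have "30 * ln 10 \<le> 656 * ?l"
    by linarith
  then show "swerling1_threshold (1 / 10 ^ 6) (9 / 10) \<le> 130.2"
    using \<open>?l > 0\<close> unfolding t by (simp add: field_simps)
qed

text \<open>The exponents come from the rational approximations \<open>40 / 19\<close> and \<open>129 / 61\<close> of the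
  required bounds \<open>2.105\<close> and \<open>2.115\<close> on the decimal logarithm.\<close>

lemma swerling1_threshold_dB:
  "\<bar>to_dB (swerling1_threshold (1 / 10 ^ 6) (9 / 10)) - 21.1\<bar> < 0.05"
proof -
  define t where "t = swerling1_threshold (1 / 10 ^ 6) (9 / 10)"
  have t: "129 \<le> t" "t \<le> 130.2"
    unfolding t_def by (fact swerling1_threshold_bounds)+
  have "log 10 (10 ^ 40) \<le> log 10 (129 ^ 19 :: real)"
    by (subst log_le_cancel_iff) simp_all
  then have "40 \<le> 19 * log 10 (129 :: real)"
    by (simp only: log_nat_power) simp
  moreover have "log 10 129 \<le> log 10 t"
    using t by simp
  moreover have "log 10 (130.2 ^ 61 :: real) \<le> log 10 (10 ^ 129)"
    by (subst log_le_cancel_iff) (simp_all add: power_divide)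
  then have "61 * log 10 (130.2 :: real) \<le> 129"
    by (simp only: log_nat_power) simp
  moreover have "log 10 t \<le> log 10 130.2"
    using t by (subst log_le_cancel_iff) simp_all
  ultimately show ?thesis
    unfolding to_dB_def t_def[symmetric] by (simp add: abs_if)
qed

theorem theorem3:
  fixes S :: sensing_system and Pfa Pd \<theta> \<sigma> :: real and K :: nat
  assumes "positive_parameters S"
    and "0 < Pfa" and "Pfa < Pd" and "Pd < 1"
    and "K \<ge> 1"
    and "\<sigma> > 0"
    and "proc_gain S (v_rel S \<theta>) > 0"
  shows "is_max_sensing_range S \<theta> \<sigma> K Pfa Pd
      (((EIRP S * rx_gain S * (wavelength S)\<^sup>2 * \<sigma>
           * real (num_subcarriers S) * real (symbols_per_cpi S)
           * proc_gain S (v_rel S \<theta>) * real K powr kappa S)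
        / ((4 * pi) ^ 3 * boltzmann S * sys_temp S * bandwidth S
           * swerling1_threshold Pfa Pd)) powr (1 / 4))
    \<and> (\<forall>\<gamma>\<ge>0. swerling1_pd Pfa \<gamma> \<ge> Pd \<longleftrightarrow> \<gamma> \<ge> swerling1_threshold Pfa Pd)
    \<and> \<bar>to_dB (swerling1_threshold (1 / 10 ^ 6) (9 / 10)) - 21.1\<bar> < 0.05"
proof -
  let ?A = "EIRP S * rx_gain S * (wavelength S)\<^sup>2 * \<sigma>
      * real (num_subcarriers S) * real (symbols_per_cpi S)
      * proc_gain S (v_rel S \<theta>) * real K powr kappa S
      / ((4 * pi) ^ 3 * boltzmann S * sys_temp S * bandwidth S)"
  have "?A > 0"
    using assms unfolding positive_parameters_def bandwidth_def by simp
  \<comment> \<open>\<open>?A\<close> omits the threshold so that it matches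
    \<open>integrated_snr_eq\<close>; simplification then merges the nested quotient into the stated
    one.\<close>
  from is_max_sensing_range_powr[OF assms(2-4) this integrated_snr_eq]
  show ?thesis
    using assms(2-4) swerling1_threshold_dB by (simp add: swerling1_pd_ge_iff)
qed

end
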